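(* Let $p$ be an odd prime and let $\rho$ be a primitive root modulo $p$. Let $r = \rho(\rho-1)^{-1} \in \mathbb{Z}_p$. Then the sequence $(0, \rho, \rho^2, \ldots, \rho^{p-1})$ of elements of $\mathbb{Z}_p$ (the primitive root construction) is a Roman pseudoterrace for $\mathbb{Z}_p$ with respect to the automorphism $x \mapsto rx$ of $\mathbb{Z}_p$.
   Context: $\mathbb{Z}_p$ denotes the integers modulo $p$ under addition. For a finite group $G$ (written additively when abelian) with an automorphism $\alpha$, the cycle of $g \in G$ under $\alpha$ is $\bar g = \{\alpha^s(g) : s \ge 1\}$. For an arrangement $\mathbf{a} = (a_1, \ldots, a_t)$ of all elements of $G$ (each exactly once), its difference/quotient triangle has lines $T_1, \ldots, T_{t-1}$, where $T_j = (a_{1+j} - a_1, a_{2+j} - a_2, \ldots, a_t - a_{t-j})$ (in multiplicative notation, $a_i^{-1}a_{i+j}$). The arrangement $\mathbf{a}$ is a Roman-$k$ pseudoterrace with respect to $\alpha$ if for every non-identity $g \in G$ and every $1 \le j \le k$, the number of entries of $T_j$ lying in $\bar g$ is at most $|\bar g|$. A Roman pseudoterrace is a Roman-$1$ pseudoterrace. *)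

theory Defs
  imports
    "HOL-Algebra.Elementary_Groups"
    "HOL-Number_Theory.Modular_Inverse"
    "HOL-Number_Theory.Residue_Primitive_Roots"
begin

definition aut_cycle :: "('a \<Rightarrow> 'a) \<Rightarrow> 'a \<Rightarrow> 'a set" where
  "aut_cycle \<alpha> g = {(\<alpha> ^^ s) g | s. s \<ge> 1}"

definition arrangement :: "('a, 'b) monoid_scheme \<Rightarrow> 'a list \<Rightarrow> bool" where
  "arrangement G a \<longleftrightarrow> distinct a \<and> set a = carrier G"

text \<open>
  Line \<open>j\<close> of the quotient triangle. The list \<open>a\<close> is indexed from 0. For \<open>j \<ge> length a\<close>,
  where the triangle has no such line, the value is the empty list.
\<close>

definition triangle_line :: "('a, 'b) monoid_scheme \<Rightarrow> 'a list \<Rightarrow> nat \<Rightarrow> 'a list" where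
  "triangle_line G a j =
     map (\<lambda>i. inv\<^bsub>G\<^esub> (a ! i) \<otimes>\<^bsub>G\<^esub> a ! (i + j)) [0..<length a - j]"

text \<open>
  That \<open>G\<close> is a finite group, \<open>\<alpha>\<close> an automorphism of it and \<open>a\<close> an arrangement of its elements
  is part of the notion. Only the values of \<open>\<alpha>\<close> on \<open>carrier G\<close> matter.
\<close>

definition Roman_k_pseudoterrace ::
    "nat \<Rightarrow> ('a, 'b) monoid_scheme \<Rightarrow> ('a \<Rightarrow> 'a) \<Rightarrow> 'a list \<Rightarrow> bool" where
  "Roman_k_pseudoterrace k G \<alpha> a \<longleftrightarrow>
     group G \<and> finite (carrier G) \<and> \<alpha> \<in> iso G G \<and> arrangement G a \<and>
     (\<forall>g \<in> carrier G - {\<one>\<^bsub>G\<^esub>}. \<forall>j \<in> {1..k}.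
        length (filter (\<lambda>x. x \<in> aut_cycle \<alpha> g) (triangle_line G a j)) \<le> card (aut_cycle \<alpha> g))"

definition Roman_pseudoterrace ::
    "('a, 'b) monoid_scheme \<Rightarrow> ('a \<Rightarrow> 'a) \<Rightarrow> 'a list \<Rightarrow> bool" where
  "Roman_pseudoterrace = Roman_k_pseudoterrace 1"

text \<open>
  The sequence \<open>(0, \<rho>, \<rho>^2, \<dots>, \<rho>^(p-1))\<close> of residues modulo \<open>p\<close>, as elements of
  \<open>integer_mod_group p\<close>, whose carrier is \<open>{0..<int p}\<close>.
\<close>

definition primitive_root_construction :: "nat \<Rightarrow> nat \<Rightarrow> int list" where
  "primitive_root_construction p \<rho> = 0 # map (\<lambda>i. int \<rho> ^ i mod int p) [1..<p]"

end

theory Submission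
  imports Defs
begin

text \<open>
  The first line of the triangle consists of \<open>\<rho>\<close> and of \<open>(\<rho> - 1) \<rho>^i\<close> for \<open>1 \<le> i \<le> p - 2\<close>.
  Replacing \<open>\<rho>\<close> by \<open>\<rho> - 1\<close> turns it into a list of distinct elements, in which each cycle is
  trivially hit at most as often as it has elements. Since \<open>\<rho> = r (\<rho> - 1)\<close>, the elements \<open>\<rho>\<close> and
  \<open>\<rho> - 1\<close> lie in the same cycle, so the replacement does not change any count.
\<close>

lemma aut_cycle_subset:
  assumes "\<alpha> ` S \<subseteq> S" "g \<in> S"
  shows "aut_cycle \<alpha> g \<subseteq> S"
proof -
  have "(\<alpha> ^^ s) g \<in> S" for s
    using assms by (induction s) auto
  then show ?thesis
    by (auto simp: aut_cycle_def)
qed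

lemma aut_cycle_closed: "\<alpha> ` aut_cycle \<alpha> g \<subseteq> aut_cycle \<alpha> g"
proof
  fix y assume "y \<in> \<alpha> ` aut_cycle \<alpha> g"
  then obtain s where "y = (\<alpha> ^^ Suc s) g"
    by (auto simp: aut_cycle_def)
  then show "y \<in> aut_cycle \<alpha> g"
    unfolding aut_cycle_def by (metis (mono_tags, lifting) le_add1 mem_Collect_eq plus_1_eq_Suc)
qed

text \<open>The cycle is finite and \<open>\<alpha>\<close> maps it injectively into itself, so
  \<open>\<alpha>\<close> permutes it. By injectivity on \<open>S\<close>, the preimage of
  \<open>\<alpha> x\<close> inside the cycle must be \<open>x\<close>. In particular
  \<open>g\<close> lies in its own cycle, although cycles are formed with \<open>s \<ge> 1\<close>
  only.\<close>

lemma aut_cycle_backward: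
  assumes "finite S" "inj_on \<alpha> S" "\<alpha> ` S \<subseteq> S" "g \<in> S" "x \<in> S" "\<alpha> x \<in> aut_cycle \<alpha> g"
  shows "x \<in> aut_cycle \<alpha> g"
proof -
  have sub: "aut_cycle \<alpha> g \<subseteq> S"
    by (rule aut_cycle_subset) fact+
  have "\<alpha> ` aut_cycle \<alpha> g = aut_cycle \<alpha> g"
    using sub assms aut_cycle_closed endo_inj_surj finite_subset inj_on_subset by metis
  then obtain y where "y \<in> aut_cycle \<alpha> g" "\<alpha> x = \<alpha> y"
    using assms by (metis imageE)
  then show ?thesis
    using assms sub by (metis inj_onD subsetD)
qed

text \<open>This is the replacement argument for a general set \<open>C\<close>: exchanging the head
  \<open>x\<close>, which may repeat an entry of \<open>xs\<close>, for \<open>y\<close> cannot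
  lower the count, and a list without repetitions meets \<open>C\<close> at most
  \<open>card C\<close> times.\<close>

lemma length_filter_le_card:
  assumes "distinct (y # xs)" "finite C" "x \<in> C \<Longrightarrow> y \<in> C"
  shows "length (filter (\<lambda>z. z \<in> C) (x # xs)) \<le> card C"
proof -
  have "length (filter (\<lambda>z. z \<in> C) (x # xs)) \<le> length (filter (\<lambda>z. z \<in> C) (y # xs))"
    using assms by simp
  also have "\<dots> = card (set (filter (\<lambda>z. z \<in> C) (y # xs)))"
    using assms by (metis distinct_card distinct_filter)
  also have "\<dots> \<le> card C"
    using assms by (intro card_mono) auto
  finally show ?thesis .
qed

text \<open>The unit \<open>c\<close> cancels, and the powers of \<open>\<rho>\<close> with
  exponents below \<open>totient p = p - 1\<close> are distinct modulo \<open>p\<close>. The factor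
  serves twice: \<open>c = \<rho>\<close> shifts the exponents by one, and
  \<open>c = \<rho> - 1\<close> gives the differences.\<close>

lemma inj_on_primroot_powers:
  assumes "prime p" "residue_primroot p \<rho>" "coprime c (int p)"
  shows "inj_on (\<lambda>i. c * int \<rho> ^ i mod int p) {..<p - 1}"
proof (rule inj_onI)
  fix i j assume ij: "i \<in> {..<p - 1}" "j \<in> {..<p - 1}"
    and "c * int \<rho> ^ i mod int p = c * int \<rho> ^ j mod int p"
  then have "[int \<rho> ^ i = int \<rho> ^ j] (mod int p)"
    using assms(3) by (metis cong_def cong_mult_lcancel)
  then have "\<rho> ^ i mod p = \<rho> ^ j mod p"
    by (metis cong_def cong_int_iff of_nat_power)
  moreover have "inj_on (\<lambda>i. \<rho> ^ i mod p) {..<p - 1}"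
    using residue_primroot_is_generator[of p \<rho>] assms prime_gt_1_nat[of p]
    by (auto simp: bij_betw_def totient_prime)
  ultimately show "i = j"
    using ij by (auto dest: inj_onD)
qed

text \<open>A unit modulo \<open>n\<close> can be cancelled, and an injective self-map of the finite
  carrier is onto.\<close>

lemma mult_iso_integer_mod_group:
  assumes "n > 0" "coprime r (int n)"
  shows "(\<lambda>x. r * x mod int n) \<in> iso (integer_mod_group n) (integer_mod_group n)"
proof (rule isoI)
  show "(\<lambda>x. r * x mod int n) \<in> hom (integer_mod_group n) (integer_mod_group n)"
    using assms by (auto simp: hom_def carrier_integer_mod_group mod_simps distrib_left)
  have "inj_on (\<lambda>x. r * x mod int n) {0..<int n}"
  proof (rule inj_onI)
    fix x y assume xy: "x \<in> {0..<int n}" "y \<in> {0..<int n}"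
      and "r * x mod int n = r * y mod int n"
    then have "[x = y] (mod int n)"
      using assms(2) by (metis cong_def cong_mult_lcancel)
    then show "x = y"
      using xy by (auto simp: cong_def)
  qed
  moreover have "(\<lambda>x. r * x mod int n) ` {0..<int n} \<subseteq> {0..<int n}"
    using assms by auto
  ultimately show "bij_betw (\<lambda>x. r * x mod int n) (carrier (integer_mod_group n))
      (carrier (integer_mod_group n))"
    using assms by (simp add: bij_betw_def carrier_integer_mod_group endo_inj_surj)
qed

lemma arrangement_primitive_root_construction:
  assumes p: "prime p" and \<rho>: "residue_primroot p \<rho>"
  shows "arrangement (integer_mod_group p) (primitive_root_construction p \<rho>)"
proof -
  have p0: "p > 0"
    using p by (rule prime_gt_0_nat)
  have cop: "coprime (int \<rho>) (int p)"
    using \<rho> by (simp add: residue_primroot_def coprime_commute)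
  have inj: "inj_on (\<lambda>i. int \<rho> ^ i mod int p) {1..<p}"
  proof (rule inj_onI)
    fix i j assume *: "i \<in> {1..<p}" "j \<in> {1..<p}"
      "int \<rho> ^ i mod int p = int \<rho> ^ j mod int p"
    \<comment> \<open>Exponents run from 1 to \<open>p - 1\<close> here but from 0 to
      \<open>p - 2\<close> in \<open>inj_on_primroot_powers\<close>; one factor
      \<open>\<rho>\<close> is split off and plays the part of \<open>c\<close>.\<close>
    then obtain i' j' where "i = Suc i'" "j = Suc j'"
      by (metis atLeastLessThan_iff not0_implies_Suc not_one_le_zero)
    with * show "i = j"
      using inj_on_primroot_powers[OF p \<rho> cop] by (auto dest: inj_onD)
  qed
  have nz: "int \<rho> ^ i mod int p \<noteq> 0" for i
  proof
    assume "int \<rho> ^ i mod int p = 0"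
    moreover have "coprime (int \<rho> ^ i) (int p)"
      using cop by simp
    ultimately have "is_unit (int p)"
      by (metis coprime_common_divisor dvd_refl mod_0_imp_dvd)
    then show False
      using p by simp
  qed
  have dist: "distinct (primitive_root_construction p \<rho>)"
    using inj nz by (auto simp: primitive_root_construction_def distinct_map)
  \<comment> \<open>Surjectivity comes from counting: \<open>p\<close> distinct entries inside a set
    of size \<open>p\<close>.\<close>
  have "set (primitive_root_construction p \<rho>) \<subseteq> {0..<int p}"
    using p0 by (auto simp: primitive_root_construction_def)
  moreover have "card (set (primitive_root_construction p \<rho>)) = p"
    using distinct_card[OF dist] p0 by (simp add: primitive_root_construction_def)
  ultimately have "set (primitive_root_construction p \<rho>) = {0..<int p}"
    by (intro card_subset_eq) auto
  with dist p0 show ?thesis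
    by (simp add: arrangement_def carrier_integer_mod_group)
qed

text \<open>The head is the difference of \<open>\<rho>\<close> and the initial 0; the other entries
  arise from \<rho>^(i+1) - \<rho>^i = (\<rho> - 1) \<rho>^i.\<close>

lemma triangle_line_primitive_root_construction:
  assumes "p \<ge> 2"
  shows "triangle_line (integer_mod_group p) (primitive_root_construction p \<rho>) 1 =
    int \<rho> mod int p # map (\<lambda>i. (int \<rho> - 1) * int \<rho> ^ i mod int p) [1..<p - 1]"
    (is "_ = _ # map ?f _")
proof -
  let ?a = "primitive_root_construction p \<rho>" and ?G = "integer_mod_group p"
  have len: "length ?a = p"
    using assms by (simp add: primitive_root_construction_def)
  \<comment> \<open>Index and exponent agree except at index 0, where the entry is 0 instead of
    \<rho>^0.\<close>
  have nth: "?a ! i = int \<rho> ^ i mod int p" if "1 \<le> i" "i < p" for i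
    using that by (cases i) (auto simp: primitive_root_construction_def simp del: upt_Suc)
  have carrier: "x mod int p \<in> carrier ?G" for x
    using assms by (simp add: carrier_integer_mod_group)
  have zero: "?a ! 0 = 0"
    by (simp add: primitive_root_construction_def)
  have "inv\<^bsub>?G\<^esub> (?a ! 0) \<otimes>\<^bsub>?G\<^esub> ?a ! (0 + 1) = int \<rho> mod int p"
    using assms nth[of 1] by (simp add: zero)
  moreover have "inv\<^bsub>?G\<^esub> (?a ! i) \<otimes>\<^bsub>?G\<^esub> ?a ! (i + 1) = ?f i" if "i \<in> set [1..<p - 1]" for i
  proof -
    have "?a ! i = int \<rho> ^ i mod int p" "?a ! (i + 1) = int \<rho> ^ (i + 1) mod int p"
      using that nth[of i] nth[of "i + 1"] by auto
    then show ?thesis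
      by (simp add: carrier mod_simps) (simp add: algebra_simps)
  qed
  moreover have "[0..<p - 1] = 0 # [1..<p - 1]"
    using assms by (simp add: upt_conv_Cons)
  ultimately show ?thesis
    unfolding triangle_line_def len by (simp cong: map_cong)
qed

theorem theorem8:
  fixes p \<rho> :: nat and r :: int
  assumes "prime p" and "odd p"
    and "residue_primroot p \<rho>"
    and "r = (int \<rho> * modular_inverse (int p) (int \<rho> - 1)) mod int p"
  shows "Roman_pseudoterrace (integer_mod_group p) (\<lambda>x. (r * x) mod int p)
           (primitive_root_construction p \<rho>)"
proof -
  let ?G = "integer_mod_group p" and ?\<alpha> = "\<lambda>x. r * x mod int p"
  let ?f = "\<lambda>i. (int \<rho> - 1) * int \<rho> ^ i mod int p"
  have p3: "p \<ge> 3"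
    using assms(1,2) prime_ge_2_nat[of p] by (cases "p = 2") auto
  have carr: "carrier ?G = {0..<int p}"
    using p3 by (simp add: carrier_integer_mod_group)
  have cop: "coprime (int \<rho>) (int p)"
    using assms(3) by (simp add: residue_primroot_def coprime_commute)
  \<comment> \<open>As \<open>p \<ge> 3\<close>, both exponents 0 and 1 lie below
    \<open>p - 1\<close>, so \<rho>^1 and \<rho>^0 differ. Hence \<open>\<rho> - 1\<close> is
    invertible and \<open>modular_inverse\<close> in the definition of \<open>r\<close> is a true
    inverse.\<close>
  have "int \<rho> mod int p \<noteq> 1 mod int p"
    using inj_onD[OF inj_on_primroot_powers[OF assms(1,3), of 1], of 1 0] p3 by force
  then have "\<not> int p dvd int \<rho> - 1"
    by (simp add: mod_eq_dvd_iff)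
  then have cop1: "coprime (int \<rho> - 1) (int p)"
    using assms(1) by (simp add: coprime_commute prime_imp_coprime)
  then have "coprime r (int p)"
    using cop assms(4) p3 by (simp add: coprime_mod_left_iff)
  then have iso: "?\<alpha> \<in> iso ?G ?G"
    using p3 by (intro mult_iso_integer_mod_group) auto
  then have inj: "inj_on ?\<alpha> (carrier ?G)" and closed: "?\<alpha> ` carrier ?G \<subseteq> carrier ?G"
    by (auto simp: iso_def bij_betw_def)
  have "[int \<rho> * (modular_inverse (int p) (int \<rho> - 1) * (int \<rho> - 1)) = int \<rho> * 1] (mod int p)"
    by (intro cong_scalar_left cong_modular_inverse2 cop1)
  then have \<alpha>: "?\<alpha> (?f 0) = int \<rho> mod int p"
    by (simp add: assms(4) cong_def mod_simps mult.assoc)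
  \<comment> \<open>The replacing element \<open>\<rho> - 1\<close> is the missing term
    \<open>?f 0\<close>, which completes the tail of the line to all values of \<open>?f\<close> on
    exponents below \<open>p - 1\<close>.\<close>
  have "[0..<p - 1] = 0 # [1..<p - 1]"
    using p3 by (simp add: upt_conv_Cons)
  moreover have "distinct (map ?f [0..<p - 1])"
    using inj_on_primroot_powers[OF assms(1,3) cop1]
    by (simp add: distinct_map atLeast0LessThan)
  ultimately have dist: "distinct (?f 0 # map ?f [1..<p - 1])"
    by (simp only: list.map)
  have line: "triangle_line ?G (primitive_root_construction p \<rho>) 1 =
      int \<rho> mod int p # map ?f [1..<p - 1]"
    using p3 by (intro triangle_line_primitive_root_construction) simp
  have "length (filter (\<lambda>x. x \<in> aut_cycle ?\<alpha> g)
      (triangle_line ?G (primitive_root_construction p \<rho>) 1)) \<le> card (aut_cycle ?\<alpha> g)"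
    if g: "g \<in> carrier ?G" for g
  proof -
    have "finite (aut_cycle ?\<alpha> g)"
      by (rule finite_subset[OF aut_cycle_subset[OF closed g]]) (simp add: carr)
    \<comment> \<open>Since \<open>?\<alpha>\<close> sends \<open>?f 0\<close> to
      \<open>\<rho>\<close>, this goes one step back along the cycle.\<close>
    moreover have "?f 0 \<in> aut_cycle ?\<alpha> g" if "int \<rho> mod int p \<in> aut_cycle ?\<alpha> g"
    proof (rule aut_cycle_backward[OF _ inj closed g])
      show "?f 0 \<in> carrier ?G" "finite (carrier ?G)"
        using p3 by (simp_all add: carr)
      show "?\<alpha> (?f 0) \<in> aut_cycle ?\<alpha> g"
        unfolding \<alpha> by (fact that)
    qed
    ultimately show ?thesis
      unfolding line by (rule length_filter_le_card[OF dist])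
  qed
  moreover have "finite (carrier ?G)"
    by (simp add: carr)
  ultimately show ?thesis
    using iso arrangement_primitive_root_construction[OF assms(1,3)]
    by (simp add: Roman_pseudoterrace_def Roman_k_pseudoterrace_def)
qed

end
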